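(* Let $H\in C^2(\mathbb{R}^4)$, $E\in\mathbb{R}$, and for $b\in\mathbb{R}^2$ let $F_b(p_1)=(h_b(p_1)-E)^2$. Assume the coercivity condition (C). Then, for every $b$, $F_b$ is coercive and attains a global minimum, and $\min_{p_1}F_b=0$ if and only if $b\in A_E$. If (C) and the unimodality condition (U) hold, then: (a) if $\mathcal{E}(b)<E$, then $F_b$ is a double well with exactly two global minimizers, namely the two roots $p_1^-<p_1^+$ of $h_b(p_1)=E$, separated by a local maximum at $m(b)$; in particular $\arg\min F_b$ is a two-point set and $F_b$ is not convex; (b) if $\mathcal{E}(b)=E$, the unique minimizer of $F_b$ is $m(b)$ (a double root); (c) if $\mathcal{E}(b)>E$, the unique minimizer of $F_b$ is $m(b)$, with $\min F_b=(\mathcal{E}(b)-E)^2$.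
   Context: Coordinates on $\mathbb{R}^4$ are $(q_1,q_2,p_1,p_2)$. For $b=(q_2,p_2)\in\mathbb{R}^2$ the fibre function is $h_b(p_1)=H(0,q_2,p_1,p_2)$; $\mathcal{E}(b)=\inf_{p_1\in\mathbb{R}}h_b(p_1)$; $A_E=\{b\in\mathbb{R}^2:\exists\,p_1\in\mathbb{R},\ h_b(p_1)=E\}$ is the admissible region. Condition (C): $h_b(p_1)\to+\infty$ as $|p_1|\to\infty$, locally uniformly in $b$; that is, every $b_0\in\mathbb{R}^2$ has a neighbourhood $N$ such that for every $M$ there is $R$ with $h_b(p_1)>M$ for all $b\in N$ and $|p_1|>R$. Condition (U): for every $b$, $h_b\in C^1(\mathbb{R})$ and there is a unique $m(b)\in\mathbb{R}$ with $h_b'<0$ on $(-\infty,m(b))$ and $h_b'>0$ on $(m(b),\infty)$. "Double root" in (b) means $h_b(m(b))=E$ and $h_b'(m(b))=0$. Coercive for $F_b$ means $F_b(p_1)\to+\infty$ as $|p_1|\to\infty$. *)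

theory Defs
  imports "HOL-Analysis.Analysis"
begin

definition C1_on_UNIV :: "('a::real_normed_vector \<Rightarrow> 'b::real_normed_vector) \<Rightarrow> bool" where
  "C1_on_UNIV f \<longleftrightarrow> (\<exists>f' :: 'a \<Rightarrow> 'a \<Rightarrow>\<^sub>L 'b.
     (\<forall>x. (f has_derivative blinfun_apply (f' x)) (at x)) \<and> continuous_on UNIV f')"

definition C2_on_UNIV :: "('a::real_normed_vector \<Rightarrow> 'b::real_normed_vector) \<Rightarrow> bool" where
  "C2_on_UNIV f \<longleftrightarrow> (\<exists>f' :: 'a \<Rightarrow> 'a \<Rightarrow>\<^sub>L 'b.
     (\<forall>x. (f has_derivative blinfun_apply (f' x)) (at x)) \<and> C1_on_UNIV f')"

text \<open>Phase space coordinates are ordered \<open>(q1, q2, p1, p2)\<close>; a base point is \<open>b = (q2, p2)\<close>,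
  and fibres lie in the section \<open>q1 = 0\<close>.\<close>

definition fibre :: "(real^4 \<Rightarrow> real) \<Rightarrow> real^2 \<Rightarrow> real \<Rightarrow> real" where
  "fibre H b p1 = H (vector [0, b $ 1, p1, b $ 2])"

lemma fibre_point_coords:
  fixes q1 q2 p1 p2 :: real
  shows "(vector [q1, q2, p1, p2] :: real^4) $ 1 = q1" "(vector [q1, q2, p1, p2] :: real^4) $ 2 = q2"
    "(vector [q1, q2, p1, p2] :: real^4) $ 3 = p1" "(vector [q1, q2, p1, p2] :: real^4) $ 4 = p2"
  unfolding vector_def by simp_all

definition sq_defect :: "(real^4 \<Rightarrow> real) \<Rightarrow> real \<Rightarrow> real^2 \<Rightarrow> real \<Rightarrow> real" where
  "sq_defect H E b p1 = (fibre H b p1 - E)\<^sup>2"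

text \<open>The infimum is taken in the reals, so this is meaningful only for fibres bounded below,
  as is the case for continuous \<open>H\<close> satisfying \<open>cond_C\<close>.\<close>

definition fibre_inf :: "(real^4 \<Rightarrow> real) \<Rightarrow> real^2 \<Rightarrow> real" where
  "fibre_inf H b = (INF p1. fibre H b p1)"

definition admissible_region :: "(real^4 \<Rightarrow> real) \<Rightarrow> real \<Rightarrow> (real^2) set" where
  "admissible_region H E = {b. \<exists>p1. fibre H b p1 = E}"

definition cond_C :: "(real^4 \<Rightarrow> real) \<Rightarrow> bool" where
  "cond_C H \<longleftrightarrow> (\<forall>b0. \<exists>N. open N \<and> b0 \<in> N \<and>
     (\<forall>M. \<exists>R. \<forall>b\<in>N. \<forall>p1. \<bar>p1\<bar> > R \<longrightarrow> fibre H b p1 > M))"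

definition is_turning_point :: "(real \<Rightarrow> real) \<Rightarrow> real \<Rightarrow> bool" where
  "is_turning_point h m \<longleftrightarrow> (\<forall>p<m. deriv h p < 0) \<and> (\<forall>p>m. deriv h p > 0)"

definition cond_U :: "(real^4 \<Rightarrow> real) \<Rightarrow> bool" where
  "cond_U H \<longleftrightarrow> (\<forall>b. fibre H b C1_differentiable_on UNIV \<and>
     (\<exists>!m. is_turning_point (fibre H b) m))"

definition turning_point :: "(real^4 \<Rightarrow> real) \<Rightarrow> real^2 \<Rightarrow> real" where
  "turning_point H b = (THE m. is_turning_point (fibre H b) m)"

definition coercive :: "(real \<Rightarrow> real) \<Rightarrow> bool" where
  "coercive f \<longleftrightarrow> filterlim f at_top at_infinity"

definition argmin_set :: "(real \<Rightarrow> real) \<Rightarrow> real set" where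
  "argmin_set f = {x. is_arg_min f (\<lambda>_. True) x}"

text \<open>\<open>has_min_value f v\<close> says that the minimum of \<open>f\<close> exists, i.e. is attained, and equals \<open>v\<close>.\<close>

definition has_min_value :: "(real \<Rightarrow> real) \<Rightarrow> real \<Rightarrow> bool" where
  "has_min_value f v \<longleftrightarrow> (\<exists>x\<in>argmin_set f. f x = v)"

definition is_local_min :: "(real \<Rightarrow> real) \<Rightarrow> real \<Rightarrow> bool" where
  "is_local_min f x \<longleftrightarrow> (\<forall>\<^sub>F y in nhds x. f x \<le> f y)"

definition is_local_max :: "(real \<Rightarrow> real) \<Rightarrow> real \<Rightarrow> bool" where
  "is_local_max f x \<longleftrightarrow> (\<forall>\<^sub>F y in nhds x. f y \<le> f x)"

text \<open>A double well: exactly two wells, i.e. local minimizers \<open>l\<close> and \<open>r\<close>, separated by a local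
  maximum at \<open>c\<close>.\<close>

definition double_well :: "(real \<Rightarrow> real) \<Rightarrow> real \<Rightarrow> real \<Rightarrow> real \<Rightarrow> bool" where
  "double_well f l c r \<longleftrightarrow>
     l < c \<and> c < r \<and> {x. is_local_min f x} = {l, r} \<and> is_local_max f c"

end

theory Submission
  imports Defs
begin

text \<open>Write \<open>h\<close> for a fibre and \<open>m\<close> for its turning point. Coercivity and continuity make \<open>(h - E)\<^sup>2\<close>
  coercive, so it attains its minimum. Under unimodality \<open>h\<close> decreases strictly up to \<open>m\<close> and
  increases strictly afterwards, so its infimum is \<open>h m\<close>. If \<open>h m < E\<close>, the intermediate value theorem
  gives one root \<open>l\<close> to the left and one root \<open>r\<close> to the right of \<open>m\<close>, and \<open>(h - E)\<^sup>2\<close> is strictly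
  monotone on each of the four intervals cut out by \<open>l < m < r\<close>, with alternating directions. If
  \<open>h m \<ge> E\<close>, then \<open>(h - E)\<^sup>2\<close> is smallest exactly where \<open>h\<close> is.\<close>

section \<open>Minimizers and coercivity of real functions\<close>

lemma argmin_set_iff: "x \<in> argmin_set f \<longleftrightarrow> (\<forall>y. f x \<le> f y)"
  by (auto simp: argmin_set_def is_arg_min_def not_less)

text \<open>Far out, \<open>f\<close> is at least \<open>f 0\<close>, so a minimum over a compact
  interval around 0 is global.\<close>

lemma coercive_attains_min:
  assumes "coercive f" "continuous_on UNIV f"
  shows "argmin_set f \<noteq> {}"
proof -
  have "\<forall>\<^sub>F x in at_infinity. f 0 \<le> f x"
    using assms(1) by (simp add: coercive_def filterlim_at_top)
  then obtain R where R: "\<And>x. R \<le> \<bar>x\<bar> \<Longrightarrow> f 0 \<le> f x"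
    by (auto simp: eventually_at_infinity)
  \<comment> \<open>\<open>R\<close> may be negative; with \<open>\<bar>R\<bar>\<close> the interval
    contains 0, and its minimizer is compared with outer points through \<open>f 0\<close>.\<close>
  have "\<exists>x\<in>{-\<bar>R\<bar>..\<bar>R\<bar>}. \<forall>y\<in>{-\<bar>R\<bar>..\<bar>R\<bar>}. f x \<le> f y"
    by (rule continuous_attains_inf) (auto intro: continuous_on_subset[OF assms(2)])
  then obtain x where x: "\<And>y. \<bar>y\<bar> \<le> \<bar>R\<bar> \<Longrightarrow> f x \<le> f y"
    by (force simp: abs_le_iff)
  have "f x \<le> f y" for y
    using x[of y] x[of 0] R[of y] by linarith
  then show ?thesis
    using argmin_set_iff by blast
qed

lemma coercive_square_diff:
  assumes "coercive h"
  shows "coercive (\<lambda>p. (h p - c)\<^sup>2)"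
proof -
  have "filterlim (\<lambda>p. - c + h p) at_top at_infinity"
    using assms unfolding coercive_def by (intro filterlim_tendsto_add_at_top[OF tendsto_const])
  then show ?thesis
    unfolding coercive_def by (intro filterlim_pow_at_top) (auto simp: algebra_simps)
qed

section \<open>Coercivity and continuity of the fibres\<close>

lemma coercive_fibre:
  assumes "cond_C H"
  shows "coercive (fibre H b)"
  unfolding coercive_def filterlim_at_top_dense
proof
  fix M
  obtain R where R: "\<And>p. \<bar>p\<bar> > R \<Longrightarrow> fibre H b p > M"
    using assms unfolding cond_C_def by metis
  \<comment> \<open>\<open>R + 1\<close> turns the strict bound of \<open>cond_C\<close> into the
    non-strict one of \<open>eventually_at_infinity\<close>.\<close>
  have "fibre H b p > M" if "R + 1 \<le> norm p" for p
    using R that by auto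
  then show "\<forall>\<^sub>F p in at_infinity. M < fibre H b p"
    unfolding eventually_at_infinity by blast
qed

lemma continuous_on_fibre:
  assumes "continuous_on UNIV H"
  shows "continuous_on UNIV (fibre H b)"
proof -
  \<comment> \<open>The fibre restricts \<open>H\<close> to an affine line in the direction of the
    third axis, which makes the dependence on \<open>p\<close> visibly continuous.\<close>
  have "(vector [0, b $ 1, p, b $ 2] :: real^4) = vector [0, b $ 1, 0, b $ 2] + p *\<^sub>R axis 3 1" for p
    by (simp add: vec_eq_iff forall_4 fibre_point_coords axis_def)
  then have "fibre H b = (\<lambda>p. H (vector [0, b $ 1, 0, b $ 2] + p *\<^sub>R axis 3 1))"
    unfolding fibre_def by (intro ext arg_cong[of _ _ H])
  then show ?thesis
    by (simp only:) (rule continuous_on_compose2[OF assms], intro continuous_intros, rule subset_UNIV)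
qed

lemma C2_on_UNIV_imp_continuous_on: "C2_on_UNIV f \<Longrightarrow> continuous_on UNIV f"
  unfolding C2_on_UNIV_def by (meson continuous_at_imp_continuous_on has_derivative_continuous)

lemma C1_has_real_derivative_deriv:
  fixes h :: "real \<Rightarrow> real"
  assumes "h C1_differentiable_on UNIV"
  shows "(h has_real_derivative deriv h x) (at x)"
  using C1_diff_imp_diff[OF assms]
  by (simp add: DERIV_deriv_iff_real_differentiable differentiable_on_def)

section \<open>Monotonicity on the two sides of a turning point\<close>

text \<open>\<open>is_turning_point\<close> prescribes no sign at \<open>m\<close> itself. The mean
  value criterion asks for the sign only in the open interval, so \<open>m\<close> may still be an
  endpoint.\<close>

lemma turning_point_strict_antimono:
  assumes C1: "h C1_differentiable_on UNIV" and m: "is_turning_point h m"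
  shows "strict_antimono_on {..m} h"
proof (rule monotone_onI)
  note D = C1_has_real_derivative_deriv[OF C1]
  fix x y assume xy: "x \<in> {..m}" "y \<in> {..m}" "x < y"
  show "h y < h x"
  proof (rule DERIV_neg_imp_decreasing_open[OF xy(3)])
    show "\<exists>d. (h has_real_derivative d) (at p) \<and> d < 0" if "x < p" "p < y" for p
      using D[of p] m xy that by (intro exI[of _ "deriv h p"]) (simp add: is_turning_point_def)
    show "continuous_on {x..y} h"
      by (intro continuous_at_imp_continuous_on ballI DERIV_isCont[OF D])
  qed
qed

lemma turning_point_strict_mono:
  assumes C1: "h C1_differentiable_on UNIV" and m: "is_turning_point h m"
  shows "strict_mono_on {m..} h"
proof (rule strict_mono_onI)
  note D = C1_has_real_derivative_deriv[OF C1]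
  fix x y assume xy: "x \<in> {m..}" "y \<in> {m..}" "x < y"
  show "h x < h y"
  proof (rule DERIV_pos_imp_increasing_open[OF xy(3)])
    show "\<exists>d. (h has_real_derivative d) (at p) \<and> d > 0" if "x < p" "p < y" for p
      using D[of p] m xy that by (intro exI[of _ "deriv h p"]) (simp add: is_turning_point_def)
    show "continuous_on {x..y} h"
      by (intro continuous_at_imp_continuous_on ballI DERIV_isCont[OF D])
  qed
qed

lemma unimodal_less:
  fixes h :: "real \<Rightarrow> real"
  assumes "strict_antimono_on {..m} h" "strict_mono_on {m..} h" "p \<noteq> m"
  shows "h m < h p"
  using assms by (cases "p < m") (auto simp: monotone_on_def)

section \<open>The double well formed by a squared unimodal function\<close>

text \<open>Points just to the left of \<open>p\<close> have smaller values. This lemma and its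
  mirror image exclude further wells.\<close>

lemma not_local_min_strict_mono:
  assumes "strict_mono_on {a..p} f" "a < p"
  shows "\<not> is_local_min f p"
proof
  assume "is_local_min f p"
  then obtain d where d: "d > 0" "\<And>y. \<bar>y - p\<bar> < d \<Longrightarrow> f p \<le> f y"
    by (auto simp: is_local_min_def eventually_nhds_metric dist_real_def)
  \<comment> \<open>The maximum keeps the witness inside \<open>{a..p}\<close> when \<open>d\<close>
    is large.\<close>
  define y where "y = max a (p - d / 2)"
  have "y \<in> {a..p}" "y < p" "\<bar>y - p\<bar> < d"
    using d(1) assms(2) by (auto simp: y_def max_def)
  then show False
    using d(2)[of y] assms strict_mono_onD[of "{a..p}" f y p] by auto
qed

lemma not_local_min_strict_antimono:
  assumes "strict_antimono_on {p..a} f" "p < a"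
  shows "\<not> is_local_min f p"
proof
  assume "is_local_min f p"
  then obtain d where d: "d > 0" "\<And>y. \<bar>y - p\<bar> < d \<Longrightarrow> f p \<le> f y"
    by (auto simp: is_local_min_def eventually_nhds_metric dist_real_def)
  define y where "y = min a (p + d / 2)"
  have "y \<in> {p..a}" "p < y" "\<bar>y - p\<bar> < d"
    using d(1) assms(2) by (auto simp: y_def min_def)
  then show False
    using d(2)[of y] assms monotone_onD[of "{p..a}" "(<)" "(>)" f p y] by auto
qed

lemma unimodal_roots:
  assumes "continuous_on UNIV h" "coercive h"
    and anti: "strict_antimono_on {..m} h" and mono: "strict_mono_on {m..} h" and "h m < E"
  obtains l r where "l < m" "m < r" "h l = E" "h r = E"
    "\<And>p. p < l \<Longrightarrow> E < h p" "\<And>p. l < p \<Longrightarrow> p < r \<Longrightarrow> h p < E" "\<And>p. r < p \<Longrightarrow> E < h p"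
proof -
  have "\<forall>\<^sub>F x in at_infinity. E \<le> h x"
    using assms(2) by (simp add: coercive_def filterlim_at_top)
  then obtain R where R: "\<And>x. R \<le> \<bar>x\<bar> \<Longrightarrow> E \<le> h x"
    by (auto simp: eventually_at_infinity)
  \<comment> \<open>The endpoint lies to the left of \<open>m\<close> and far enough out that
    \<open>h\<close> is at least \<open>E\<close> there.\<close>
  have "\<exists>l. - (\<bar>R\<bar> + \<bar>m\<bar>) \<le> l \<and> l \<le> m \<and> h l = E"
    by (rule IVT2') (use assms R in \<open>auto intro: continuous_on_subset\<close>)
  then obtain l where l: "l \<le> m" "h l = E" by blast
  have "\<exists>r. m \<le> r \<and> r \<le> \<bar>R\<bar> + \<bar>m\<bar> \<and> h r = E"
    by (rule IVT') (use assms R in \<open>auto intro: continuous_on_subset\<close>)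
  then obtain r where r: "m \<le> r" "h r = E" by blast
  have lm: "l < m" and mr: "m < r"
    using l r \<open>h m < E\<close> by (auto simp: less_le)
  have A: "h y < h x" if "x < y" "y \<le> m" for x y
    using monotone_onD[OF anti, of x y] that by auto
  have B: "h x < h y" if "x < y" "m \<le> x" for x y
    using monotone_onD[OF mono, of x y] that by auto
  show thesis
  proof (rule that[OF lm mr l(2) r(2)])
    show "E < h p" if "p < l" for p using A[of p l] that l by auto
    show "E < h p" if "r < p" for p using B[of r p] that r by auto
    show "h p < E" if "l < p" "p < r" for p
      using A[of l p] B[of p r] that l r by (cases "p \<le> m") auto
  qed
qed

text \<open>On each of the four intervals both the direction of \<open>h\<close> and the sign of
  \<open>h - E\<close> are fixed, and together they give the direction of the square.\<close>

lemma unimodal_double_well: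
  assumes "continuous_on UNIV h" "coercive h"
    and anti: "strict_antimono_on {..m} h" and mono: "strict_mono_on {m..} h" and "h m < E"
  obtains l r where "l < r" "{p. h p = E} = {l, r}" "double_well (\<lambda>p. (h p - E)\<^sup>2) l m r"
proof -
  let ?F = "\<lambda>p. (h p - E)\<^sup>2"
  obtain l r where lr: "l < m" "m < r" "h l = E" "h r = E"
    and out_l: "\<And>p. p < l \<Longrightarrow> E < h p"
    and between: "\<And>p. l < p \<Longrightarrow> p < r \<Longrightarrow> h p < E"
    and out_r: "\<And>p. r < p \<Longrightarrow> E < h p"
    using unimodal_roots[OF assms] by metis
  have A: "h y < h x" if "x < y" "y \<le> m" for x y
    using monotone_onD[OF anti, of x y] that by auto
  have B: "h x < h y" if "x < y" "m \<le> x" for x y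
    using monotone_onD[OF mono, of x y] that by auto
  have in_le: "h p \<le> E" if "l \<le> p" "p \<le> r" for p
    using between[of p] that lr by (cases "p = l"; cases "p = r") auto
  have roots: "{p. h p = E} = {l, r}"
    using lr out_l out_r between by (auto, metis less_irrefl linorder_neqE)
  have F1: "strict_antimono_on {p..l} ?F" for p
  proof (rule monotone_onI)
    fix x y assume xy: "x \<in> {p..l}" "y \<in> {p..l}" "x < y"
    then have "h y < h x" "E \<le> h y"
      using A[of x y] out_l[of y] lr by (auto simp: le_less)
    then show "?F y < ?F x" by (intro power2_strict_mono) auto
  qed
  have F2: "strict_mono_on {l..p} ?F" if "p \<le> m" for p
  proof (rule strict_mono_onI)
    fix x y assume xy: "x \<in> {l..p}" "y \<in> {l..p}" "x < y"
    then have "h y < h x" "h x \<le> E"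
      using A[of x y] in_le[of x] lr that by auto
    then show "?F x < ?F y" by (intro power2_strict_mono) auto
  qed
  have F3: "strict_antimono_on {p..r} ?F" if "m \<le> p" for p
  proof (rule monotone_onI)
    fix x y assume xy: "x \<in> {p..r}" "y \<in> {p..r}" "x < y"
    then have "h x < h y" "h y \<le> E"
      using B[of x y] in_le[of y] lr that by auto
    then show "?F y < ?F x" by (intro power2_strict_mono) auto
  qed
  have F4: "strict_mono_on {r..p} ?F" for p
  proof (rule strict_mono_onI)
    fix x y assume xy: "x \<in> {r..p}" "y \<in> {r..p}" "x < y"
    then have "h x < h y" "E \<le> h x"
      using B[of x y] out_r[of x] lr by (auto simp: le_less)
    then show "?F x < ?F y" by (intro power2_strict_mono) auto
  qed
  have "\<not> is_local_min ?F p" if neq: "p \<noteq> l" "p \<noteq> r" for p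
  proof -
    \<comment> \<open>In every case the square falls strictly from \<open>p\<close> towards the root
      on the same side of \<open>m\<close>; \<open>m\<close> itself fits both middle cases.\<close>
    consider "p < l" | "l < p" "p \<le> m" | "m \<le> p" "p < r" | "r < p"
      using neq by linarith
    then show ?thesis
    proof cases
      case 1 show ?thesis by (rule not_local_min_strict_antimono[OF F1 1])
    next
      case 2 show ?thesis by (rule not_local_min_strict_mono[OF F2[OF 2(2)] 2(1)])
    next
      case 3 show ?thesis by (rule not_local_min_strict_antimono[OF F3[OF 3(1)] 3(2)])
    next
      case 4 show ?thesis by (rule not_local_min_strict_mono[OF F4 4])
    qed
  qed
  moreover have "is_local_min ?F l" "is_local_min ?F r"
    using lr by (simp_all add: is_local_min_def)
  ultimately have "{x. is_local_min ?F x} = {l, r}"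
    by auto
  moreover have "is_local_max ?F m"
  proof -
    \<comment> \<open>Between the roots \<open>h\<close> stays below \<open>E\<close>, so the
      smallest value of \<open>h\<close> is the one farthest from \<open>E\<close>.\<close>
    have "?F p \<le> ?F m" if "p \<in> {l<..<r}" for p
    proof -
      have "h m \<le> h p" "h p \<le> E"
        using unimodal_less[OF anti mono, of p] in_le[of p] that by (cases "p = m"; auto)+
      then show ?thesis by (simp add: abs_le_square_iff[symmetric])
    qed
    moreover have "\<forall>\<^sub>F p in nhds m. p \<in> {l<..<r}"
      using lr by (intro eventually_nhds_in_open) auto
    ultimately show ?thesis
      unfolding is_local_max_def by (auto elim: eventually_mono)
  qed
  ultimately have "double_well ?F l m r"
    using lr by (simp add: double_well_def)
  then show thesis
    using that[OF _ roots] lr by linarith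
qed

section \<open>Global minimizers of a squared difference\<close>

text \<open>The root \<open>q\<close> makes the minimum 0, and a square vanishes only at
  roots.\<close>

lemma argmin_set_square_diff:
  assumes "h q = c"
  shows "argmin_set (\<lambda>p. (h p - c)\<^sup>2) = {p. h p = c}"
proof -
  have "(\<forall>y. (h p - c)\<^sup>2 \<le> (h y - c)\<^sup>2) \<longleftrightarrow> h p = c" for p
  proof
    assume "\<forall>y. (h p - c)\<^sup>2 \<le> (h y - c)\<^sup>2"
    then have "(h p - c)\<^sup>2 \<le> (h q - c)\<^sup>2" ..
    then show "h p = c"
      using assms by simp
  qed simp
  then show ?thesis
    by (simp add: argmin_set_iff set_eq_iff)
qed

text \<open>Under convexity the midpoint of \<open>l\<close> and \<open>r\<close> would be a third
  minimizer.\<close>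

lemma not_convex_two_minimizers:
  assumes "argmin_set f = {l, r}" "l \<noteq> r"
  shows "\<not> convex_on UNIV f"
proof
  assume "convex_on UNIV f"
  moreover have lr: "\<And>y. f l \<le> f y" "\<And>y. f r \<le> f y"
    using assms(1) argmin_set_iff[of _ f] by auto
  ultimately have "f ((1 - 1/2) *\<^sub>R l + (1/2) *\<^sub>R r) \<le> (1 - 1/2) * f l + 1/2 * f r"
    by (intro convex_onD) auto
  moreover have "f l = f r"
    using lr[of l] lr[of r] by (meson antisym lr)
  ultimately have "f ((l + r) / 2) \<le> f l"
    by (simp add: field_simps)
  then have "(l + r) / 2 \<in> argmin_set f"
    using lr order_trans unfolding argmin_set_iff by blast
  then show False
    using assms by (auto simp: field_simps)
qed

text \<open>With \<open>c \<le> h m\<close> all differences \<open>h p - c\<close> are nonnegative,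
  so squaring preserves their order. Equality is allowed, so the critical level is covered
  too.\<close>

lemma argmin_set_square_diff_above:
  assumes "\<And>p. p \<noteq> m \<Longrightarrow> h m < h p" "c \<le> h m"
  shows "argmin_set (\<lambda>p. (h p - c)\<^sup>2) = {m}"
proof -
  have "(h m - c)\<^sup>2 < (h p - c)\<^sup>2" if "p \<noteq> m" for p
    using assms(1)[OF that] assms(2) by (intro power2_strict_mono) auto
  then show ?thesis
    by (auto simp: argmin_set_iff set_eq_iff) (metis linorder_not_le, metis less_imp_le order_refl)
qed

section \<open>Application to the fibres and their squared defect\<close>

lemma sq_defect_eq: "sq_defect H E b = (\<lambda>p. (fibre H b p - E)\<^sup>2)"
  by (simp add: sq_defect_def fun_eq_iff)

lemma coercive_sq_defect: "cond_C H \<Longrightarrow> coercive (sq_defect H E b)"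
  unfolding sq_defect_eq by (intro coercive_square_diff coercive_fibre)

lemma argmin_sq_defect_nonempty:
  assumes "continuous_on UNIV H" "cond_C H"
  shows "argmin_set (sq_defect H E b) \<noteq> {}"
proof (rule coercive_attains_min[OF coercive_sq_defect[OF assms(2)]])
  show "continuous_on UNIV (sq_defect H E b)"
    unfolding sq_defect_eq by (intro continuous_intros continuous_on_fibre assms(1))
qed

text \<open>Squares are nonnegative, so any root of the fibre equation is a minimizer with value
  0.\<close>

lemma has_min_value_sq_defect_0_iff:
  "has_min_value (sq_defect H E b) 0 \<longleftrightarrow> b \<in> admissible_region H E"
  by (auto simp: has_min_value_def admissible_region_def argmin_set_iff sq_defect_eq)

lemma cond_U_C1: "cond_U H \<Longrightarrow> fibre H b C1_differentiable_on UNIV"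
  by (simp add: cond_U_def)

lemma cond_U_turning_point: "cond_U H \<Longrightarrow> is_turning_point (fibre H b) (turning_point H b)"
  unfolding cond_U_def turning_point_def by (rule theI') blast

text \<open>Both composed facts contribute a premise \<open>cond_U H\<close>, hence the later
  \<open>[OF U U]\<close>.\<close>

lemmas fibre_strict_antimono = turning_point_strict_antimono[OF cond_U_C1 cond_U_turning_point]
lemmas fibre_strict_mono = turning_point_strict_mono[OF cond_U_C1 cond_U_turning_point]

lemma fibre_turning_point_less:
  assumes "cond_U H" "p \<noteq> turning_point H b"
  shows "fibre H b (turning_point H b) < fibre H b p"
  using assms by (intro unimodal_less fibre_strict_antimono fibre_strict_mono)

lemma fibre_turning_point_le:
  assumes "cond_U H"
  shows "fibre H b (turning_point H b) \<le> fibre H b p"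
  using fibre_turning_point_less[OF assms, of p b] by (cases "p = turning_point H b") auto

text \<open>The infimum is attained at the turning point, so the real-valued \<open>INF\<close> is a
  true minimum.\<close>

lemma fibre_inf_eq:
  assumes "cond_U H"
  shows "fibre_inf H b = fibre H b (turning_point H b)"
  unfolding fibre_inf_def
  by (rule cInf_eq_minimum) (auto simp: fibre_turning_point_le[OF assms])

text \<open>This is the derivative half of the double root: the derivative vanishes at
  \<open>m\<close> because the fibre has its minimum there.\<close>

lemma fibre_deriv_turning_point:
  assumes "cond_U H"
  shows "(fibre H b has_real_derivative 0) (at (turning_point H b))"
proof -
  let ?m = "turning_point H b"
  have D: "(fibre H b has_real_derivative deriv (fibre H b) ?m) (at ?m)"
    by (rule C1_has_real_derivative_deriv[OF cond_U_C1[OF assms]])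
  moreover have "deriv (fibre H b) ?m = 0"
    \<comment> \<open>The minimum is global, so radius 1 serves as well as any other.\<close>
    by (rule DERIV_local_min[OF D zero_less_one]) (simp add: fibre_turning_point_le[OF assms])
  ultimately show ?thesis
    by simp
qed

text \<open>\<open>double_well\<close> speaks of local minimizers only; the global ones are
  identified with the roots by \<open>argmin_set_square_diff\<close>.\<close>

lemma sq_defect_double_well:
  assumes "continuous_on UNIV H" "cond_C H" and U: "cond_U H" and "fibre_inf H b < E"
  obtains l r where "l < r" "{p. fibre H b p = E} = {l, r}"
    "argmin_set (sq_defect H E b) = {l, r}"
    "double_well (sq_defect H E b) l (turning_point H b) r"
proof -
  have "fibre H b (turning_point H b) < E"
    using assms(4) by (simp add: fibre_inf_eq[OF U])
  then obtain l r where lr: "l < r" "{p. fibre H b p = E} = {l, r}"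
    "double_well (sq_defect H E b) l (turning_point H b) r"
    unfolding sq_defect_eq
    by (rule unimodal_double_well[OF continuous_on_fibre[OF assms(1)] coercive_fibre[OF assms(2)]
        fibre_strict_antimono[OF U U] fibre_strict_mono[OF U U]])
  have "fibre H b l = E"
    using lr(2) by blast
  then have "argmin_set (sq_defect H E b) = {l, r}"
    unfolding sq_defect_eq using lr(2) by (simp add: argmin_set_square_diff)
  then show thesis
    using that lr by blast
qed

lemma argmin_sq_defect_above:
  assumes "cond_U H" "E \<le> fibre_inf H b"
  shows "argmin_set (sq_defect H E b) = {turning_point H b}"
  unfolding sq_defect_eq
  by (rule argmin_set_square_diff_above)
    (use assms in \<open>simp_all add: fibre_inf_eq fibre_turning_point_less\<close>)

theorem proposition7p2:
  fixes H :: "real^4 \<Rightarrow> real" and E :: real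
  assumes "C2_on_UNIV H" and "cond_C H"
  shows "(\<forall>b. coercive (sq_defect H E b) \<and>
              argmin_set (sq_defect H E b) \<noteq> {} \<and>
              (has_min_value (sq_defect H E b) 0 \<longleftrightarrow> b \<in> admissible_region H E)) \<and>
         (cond_U H \<longrightarrow> (\<forall>b.
            (fibre_inf H b < E \<longrightarrow>
               (\<exists>pminus pplus. pminus < pplus \<and>
                  {p. fibre H b p = E} = {pminus, pplus} \<and>
                  argmin_set (sq_defect H E b) = {pminus, pplus} \<and>
                  double_well (sq_defect H E b) pminus (turning_point H b) pplus) \<and>
               card (argmin_set (sq_defect H E b)) = 2 \<and>
               \<not> convex_on UNIV (sq_defect H E b)) \<and>
            (fibre_inf H b = E \<longrightarrow>
               argmin_set (sq_defect H E b) = {turning_point H b} \<and>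
               fibre H b (turning_point H b) = E \<and>
               (fibre H b has_real_derivative 0) (at (turning_point H b))) \<and>
            (fibre_inf H b > E \<longrightarrow>
               argmin_set (sq_defect H E b) = {turning_point H b} \<and>
               has_min_value (sq_defect H E b) ((fibre_inf H b - E)\<^sup>2))))"
proof (intro conjI allI impI)
  have cont: "continuous_on UNIV H"
    by (rule C2_on_UNIV_imp_continuous_on[OF assms(1)])
  fix b
  show "coercive (sq_defect H E b)"
    by (rule coercive_sq_defect[OF assms(2)])
  show "argmin_set (sq_defect H E b) \<noteq> {}"
    by (rule argmin_sq_defect_nonempty[OF cont assms(2)])
  show "has_min_value (sq_defect H E b) 0 \<longleftrightarrow> b \<in> admissible_region H E"
    by (rule has_min_value_sq_defect_0_iff)
  assume U: "cond_U H"
  {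
    assume below: "fibre_inf H b < E"
    obtain l r where lr: "l < r" "{p. fibre H b p = E} = {l, r}"
      "argmin_set (sq_defect H E b) = {l, r}"
      "double_well (sq_defect H E b) l (turning_point H b) r"
      by (rule sq_defect_double_well[OF cont assms(2) U below])
    then show "\<exists>pminus pplus. pminus < pplus \<and> {p. fibre H b p = E} = {pminus, pplus} \<and>
        argmin_set (sq_defect H E b) = {pminus, pplus} \<and>
        double_well (sq_defect H E b) pminus (turning_point H b) pplus"
      by blast
    show "card (argmin_set (sq_defect H E b)) = 2"
      using lr by simp
    show "\<not> convex_on UNIV (sq_defect H E b)"
      using not_convex_two_minimizers[OF lr(3)] lr(1) by simp
  next
    assume crit: "fibre_inf H b = E"
    show "argmin_set (sq_defect H E b) = {turning_point H b}"
      by (rule argmin_sq_defect_above[OF U]) (simp add: crit)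
    show "fibre H b (turning_point H b) = E"
      using crit fibre_inf_eq[OF U] by simp
    show "(fibre H b has_real_derivative 0) (at (turning_point H b))"
      by (rule fibre_deriv_turning_point[OF U])
  next
    assume above: "fibre_inf H b > E"
    show argmin: "argmin_set (sq_defect H E b) = {turning_point H b}"
      by (rule argmin_sq_defect_above[OF U]) (use above in simp)
    show "has_min_value (sq_defect H E b) ((fibre_inf H b - E)\<^sup>2)"
      \<comment> \<open>The value is read off at the turning point, where the fibre equals its
        infimum.\<close>
      unfolding has_min_value_def argmin by (simp add: sq_defect_def fibre_inf_eq[OF U])
  }
qed

end
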